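(* Let $n\geq 2$, let $A$ be a non-hermitian $n\times n$ quaternionic matrix with numerical range $W$, let $B=W\cap\mathbb{C}$, $B^+=W\cap\mathbb{C}^+$, $B^-=W\cap\mathbb{C}^-$, $m=\min (W\cap\mathbb{R})$ and $M=\max (W\cap\mathbb{R})$. Assume $m<M$ and let $\boldsymbol{\omega}=(\omega_1,\omega_2)\in B^+$ with $\omega_2>0$. Let $l_{\boldsymbol{\omega}}$ be the line in $\mathbb{C}\cong\mathbb{R}^2$ through $\boldsymbol{\omega}$ and $(m,0)$, and let $L_{\boldsymbol{\omega}}$ be the line through $\boldsymbol{\omega}$ and $(M,0)$. Then $\boldsymbol{\omega}\in\mathcal{C}(B)$ if and only if $$\big(l_{\boldsymbol{\omega}}\cap (B^-)^{\mathrm{o}}\big)\cup\big(L_{\boldsymbol{\omega}}\cap (B^-)^{\mathrm{o}}\big)=\emptyset,$$ where $(B^-)^{\mathrm{o}}$ is the interior of $B^-$ in $\mathbb{R}^2$ and $\mathcal{C}(B)$ is the star-center of $B$.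
   Context: $\mathbb{H}$ is the real algebra of Hamilton quaternions with basis $1,i,j,k$, and $\mathbb{C}=\mathrm{span}_{\mathbb{R}}\{1,i\}\subset\mathbb{H}$, identified with $\mathbb{R}^2$ by writing $x+iy$ as $(x,y)$; $\mathbb{C}^+=\{y\ge 0\}$ and $\mathbb{C}^-=\{y\le 0\}$ are the closed upper and lower half planes. The numerical range of $A$ is $W=\{\boldsymbol{x}^*A\boldsymbol{x}:\boldsymbol{x}\in\mathbb{H}^n,\ |\boldsymbol{x}|=1\}$, where $\boldsymbol{x}^*$ is the conjugate transpose and $|\boldsymbol{x}|^2=\boldsymbol{x}^*\boldsymbol{x}$; $W\cap\mathbb{R}$ is nonempty. $A$ is hermitian if $A=A^*$. Explicitly, $l_{\boldsymbol{\omega}}=\{(x,y): x=\frac{\omega_1-m}{\omega_2}y+m\}$ and $L_{\boldsymbol{\omega}}=\{(x,y): x=\frac{\omega_1-M}{\omega_2}y+M\}$. With $y_m=\min\{y:(x,y)\in B\}$, $x_1(y)=\min\{x:(x,y)\in B^-\}$ and $x_2(y)=\max\{x:(x,y)\in B^-\}$ for $y\in[y_m,0]$, one has $(B^-)^{\mathrm{o}}=\{(x,y): y_m<y<0,\ x_1(y)<x<x_2(y)\}$. The star-center of a set $B$ is $\mathcal{C}(B)=\{b_0\in B:(1-\alpha)b_0+\alpha b\in B\text{ for all } b\in B,\ \alpha\in[0,1]\}$. *)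

theory Defs
  imports "HOL-Analysis.Analysis"
begin

codatatype quat = Quat (QRe: real) (QIm1: real) (QIm2: real) (QIm3: real)

lemma quat_eq_iff: "x = y \<longleftrightarrow> QRe x = QRe y \<and> QIm1 x = QIm1 y \<and> QIm2 x = QIm2 y \<and> QIm3 x = QIm3 y"
  by (auto intro: quat.expand)

instantiation quat :: ab_group_add
begin

primcorec zero_quat where
  "QRe 0 = 0" | "QIm1 0 = 0" | "QIm2 0 = 0" | "QIm3 0 = 0"

primcorec plus_quat where
  "QRe (x + y) = QRe x + QRe y"
| "QIm1 (x + y) = QIm1 x + QIm1 y"
| "QIm2 (x + y) = QIm2 x + QIm2 y"
| "QIm3 (x + y) = QIm3 x + QIm3 y"

primcorec uminus_quat where
  "QRe (- x) = - QRe x" | "QIm1 (- x) = - QIm1 x" | "QIm2 (- x) = - QIm2 x" | "QIm3 (- x) = - QIm3 x"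

primcorec minus_quat where
  "QRe (x - y) = QRe x - QRe y"
| "QIm1 (x - y) = QIm1 x - QIm1 y"
| "QIm2 (x - y) = QIm2 x - QIm2 y"
| "QIm3 (x - y) = QIm3 x - QIm3 y"

instance
  by standard (simp_all add: quat_eq_iff)

end

instantiation quat :: ring_1
begin

primcorec one_quat where
  "QRe 1 = 1" | "QIm1 1 = 0" | "QIm2 1 = 0" | "QIm3 1 = 0"

primcorec times_quat where
  "QRe (x * y) = QRe x * QRe y - QIm1 x * QIm1 y - QIm2 x * QIm2 y - QIm3 x * QIm3 y"
| "QIm1 (x * y) = QRe x * QIm1 y + QIm1 x * QRe y + QIm2 x * QIm3 y - QIm3 x * QIm2 y"
| "QIm2 (x * y) = QRe x * QIm2 y - QIm1 x * QIm3 y + QIm2 x * QRe y + QIm3 x * QIm1 y"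
| "QIm3 (x * y) = QRe x * QIm3 y + QIm1 x * QIm2 y - QIm2 x * QIm1 y + QIm3 x * QRe y"

instance
  by standard (simp_all add: quat_eq_iff algebra_simps)

end

lemma quat_units:
  "Quat 0 1 0 0 * Quat 0 1 0 0 = - 1"
  "Quat 0 0 1 0 * Quat 0 0 1 0 = - 1"
  "Quat 0 0 0 1 * Quat 0 0 0 1 = - 1"
  "Quat 0 1 0 0 * Quat 0 0 1 0 = Quat 0 0 0 1"
  "Quat 0 0 1 0 * Quat 0 0 0 1 = Quat 0 1 0 0"
  "Quat 0 0 0 1 * Quat 0 1 0 0 = Quat 0 0 1 0"
  by (simp_all add: quat_eq_iff)

instantiation quat :: real_algebra_1
begin

primcorec scaleR_quat where
  "QRe (scaleR r x) = r * QRe x"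
| "QIm1 (scaleR r x) = r * QIm1 x"
| "QIm2 (scaleR r x) = r * QIm2 x"
| "QIm3 (scaleR r x) = r * QIm3 x"

instance
  by standard (simp_all add: quat_eq_iff algebra_simps)

end

instantiation quat :: real_inner
begin

definition inner_quat :: "quat \<Rightarrow> quat \<Rightarrow> real" where
  "inner_quat x y = QRe x * QRe y + QIm1 x * QIm1 y + QIm2 x * QIm2 y + QIm3 x * QIm3 y"

definition norm_quat :: "quat \<Rightarrow> real" where
  "norm_quat x = sqrt (inner x x)"

definition sgn_quat :: "quat \<Rightarrow> quat" where
  "sgn_quat x = x /\<^sub>R norm x"

definition dist_quat :: "quat \<Rightarrow> quat \<Rightarrow> real" where
  "dist_quat x y = norm (x - y)"

definition uniformity_quat :: "(quat \<times> quat) filter" where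
  "uniformity_quat = (INF e\<in>{0 <..}. principal {(x, y). dist x y < e})"

definition open_quat :: "quat set \<Rightarrow> bool" where
  "open_quat U \<longleftrightarrow> (\<forall>x\<in>U. eventually (\<lambda>(x', y). x' = x \<longrightarrow> y \<in> U) uniformity)"

instance
proof
  fix x y z :: quat and r :: real and U :: "quat set"
  show "inner x y = inner y x"
    "inner (x + y) z = inner x z + inner y z"
    "inner (scaleR r x) y = r * inner x y"
    by (simp_all add: inner_quat_def algebra_simps)
  show "0 \<le> inner x x"
    by (simp add: inner_quat_def)
  show "inner x x = 0 \<longleftrightarrow> x = 0"
  proof -
    have "0 \<le> (QRe x)\<^sup>2" "0 \<le> (QIm1 x)\<^sup>2" "0 \<le> (QIm2 x)\<^sup>2" "0 \<le> (QIm3 x)\<^sup>2" by simp_all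
    then have "inner x x = 0 \<longleftrightarrow>
        (QRe x)\<^sup>2 = 0 \<and> (QIm1 x)\<^sup>2 = 0 \<and> (QIm2 x)\<^sup>2 = 0 \<and> (QIm3 x)\<^sup>2 = 0"
      unfolding inner_quat_def power2_eq_square by linarith
    then show ?thesis by (simp add: quat_eq_iff)
  qed
qed (fact norm_quat_def sgn_quat_def dist_quat_def uniformity_quat_def open_quat_def)+

end

instantiation quat :: euclidean_space
begin

definition Basis_quat :: "quat set" where
  "Basis_quat = {1, Quat 0 1 0 0, Quat 0 0 1 0, Quat 0 0 0 1}"

instance
proof
  show "(Basis :: quat set) \<noteq> {}" "finite (Basis :: quat set)"
    by (simp_all add: Basis_quat_def)
  show "inner u v = (if u = v then 1 else 0)" if "u \<in> Basis" "v \<in> Basis" for u v :: quat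
  proof -
    have one: "(1 :: quat) = Quat 1 0 0 0" by (simp add: quat_eq_iff)
    show ?thesis
      using that unfolding Basis_quat_def one insert_iff empty_iff
      by (elim disjE) (simp_all add: inner_quat_def)
  qed
  show "(\<forall>u\<in>Basis. inner x u = 0) \<longleftrightarrow> x = 0" for x :: quat
    unfolding quat_eq_iff[of x] by (simp add: Basis_quat_def inner_quat_def)
qed

end

primcorec qcnj :: "quat \<Rightarrow> quat" where
  "QRe (qcnj x) = QRe x"
| "QIm1 (qcnj x) = - QIm1 x"
| "QIm2 (qcnj x) = - QIm2 x"
| "QIm3 (qcnj x) = - QIm3 x"

lemma of_real_quat: "of_real r = Quat r 0 0 0"
  by (simp add: of_real_def quat_eq_iff)

definition quat_of_complex :: "complex \<Rightarrow> quat" where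
  "quat_of_complex z = Quat (Re z) (Im z) 0 0"

definition conj_transpose :: "quat ^ 'n ^ 'm \<Rightarrow> quat ^ 'm ^ 'n" where
  "conj_transpose A = (\<chi> i j. qcnj (A $ j $ i))"

definition hermitian :: "quat ^ 'n ^ 'n \<Rightarrow> bool" where
  "hermitian A \<longleftrightarrow> A = conj_transpose A"

text \<open>The product \<open>x\<^sup>* y\<close> of a conjugate-transposed column with a column.\<close>

definition hprod :: "quat ^ 'n \<Rightarrow> quat ^ 'n \<Rightarrow> quat" where
  "hprod x y = (\<Sum>i\<in>UNIV. qcnj (x $ i) * y $ i)"

text \<open>The library norm on \<^typ>\<open>quat ^ 'n\<close> satisfies \<open>|x|\<^sup>2 = x\<^sup>* x\<close>.\<close>

lemma hprod_self: "hprod x x = of_real ((norm x)\<^sup>2)"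
proof -
  have "qcnj q * q = of_real ((norm q)\<^sup>2)" for q
    by (simp add: of_real_quat quat_eq_iff norm_quat_def inner_quat_def)
  then have "hprod x x = of_real (\<Sum>i\<in>UNIV. (norm (x $ i))\<^sup>2)"
    by (simp add: hprod_def)
  also have "(\<Sum>i\<in>UNIV. (norm (x $ i))\<^sup>2) = (norm x)\<^sup>2"
    by (simp add: norm_vec_def L2_set_def sum_nonneg)
  finally show ?thesis .
qed

definition numerical_range :: "quat ^ 'n ^ 'n \<Rightarrow> quat set" where
  "numerical_range A = {hprod x (A *v x) | x. norm x = 1}"

text \<open>\<open>W \<inter> \<real>\<close> and \<open>W \<inter> \<complex>\<close>, with \<open>\<real>\<close> and \<open>\<complex> = span {1, i}\<close> replaced by the library
  types; the topology of \<^typ>\<open>complex\<close> is that of \<open>\<real>\<^sup>2\<close>.\<close>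

definition real_part_of :: "quat set \<Rightarrow> real set" where
  "real_part_of W = {r. of_real r \<in> W}"

definition complex_part_of :: "quat set \<Rightarrow> complex set" where
  "complex_part_of W = {z. quat_of_complex z \<in> W}"

text \<open>The line through \<open>\<omega>\<close> and the real point \<open>(c, 0)\<close>; only meaningful for \<open>Im \<omega> \<noteq> 0\<close>.\<close>

definition line_to_real :: "complex \<Rightarrow> real \<Rightarrow> complex set" where
  "line_to_real \<omega> c = {z. Re z = (Re \<omega> - c) / Im \<omega> * Im z + c}"

lemma line_to_real_eq_affine_hull:
  assumes "Im \<omega> \<noteq> 0"
  shows "line_to_real \<omega> c = affine hull {\<omega>, complex_of_real c}"
proof (intro set_eqI iffI)
  fix z assume "z \<in> line_to_real \<omega> c"
  then have "z = (Im z / Im \<omega>) *\<^sub>R \<omega> + (1 - Im z / Im \<omega>) *\<^sub>R complex_of_real c"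
    using assms by (simp add: line_to_real_def complex_eq_iff algebra_simps diff_divide_distrib)
  then show "z \<in> affine hull {\<omega>, complex_of_real c}"
    unfolding affine_hull_2 by (intro CollectI exI[of _ "Im z / Im \<omega>"] exI[of _ "1 - Im z / Im \<omega>"]) simp
next
  fix z assume "z \<in> affine hull {\<omega>, complex_of_real c}"
  then obtain u v where z: "z = u *\<^sub>R \<omega> + v *\<^sub>R complex_of_real c" and "u + v = 1"
    by (auto simp: affine_hull_2)
  then have "v = 1 - u" by simp
  with z have "Re z = u * Re \<omega> + (1 - u) * c" "Im z = u * Im \<omega>"
    by simp_all
  with assms show "z \<in> line_to_real \<omega> c"
    unfolding line_to_real_def by simp argo
qed

definition star_center :: "'a::real_vector set \<Rightarrow> 'a set" where
  "star_center B = {b0 \<in> B. \<forall>b\<in>B. \<forall>\<alpha>\<in>{0..1}. (1 - \<alpha>) *\<^sub>R b0 + \<alpha> *\<^sub>R b \<in> B}"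

end

theory Submission
  imports Defs
begin

text \<open>
  Similar quaternions lie together in \<open>W\<close>, because \<open>(x u)\<^sup>* A (x u) = u\<^sup>* (x\<^sup>* A x) u\<close> for a unit
  quaternion \<open>u\<close>. So \<open>B\<close> is symmetric about the real axis, and its upper half \<open>B\<^sup>+\<close> consists of the
  points \<open>(Re q, |Im q|)\<close> with \<open>q = x\<^sup>* A x\<close> and \<open>|x| = 1\<close>. The theorem is then plane geometry, given
  that \<open>B\<^sup>+\<close>, hence also its mirror image \<open>B\<^sup>-\<close>, is convex (a theorem of So and Thompson).

  Convexity (lemma \<open>convex_upper_complex_part\<close>). Let unit vectors \<open>x\<close>, \<open>y\<close> produce two points of \<open>B\<^sup>+\<close>
  with different abscissae, and let \<open>c\<close> be an abscissa strictly between them. For every unit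
  quaternion \<open>v\<close> there is exactly one \<open>\<rho> > 0\<close> for which \<open>X = x + y (\<rho> v)\<close> has abscissa \<open>c\<close>: it is the
  positive root of a quadratic whose outer coefficients have opposite signs. So \<open>X\<close> depends
  continuously on \<open>v\<close>, which runs over the connected sphere \<open>S\<^sup>3\<close>, and it suffices to
  find one \<open>v\<close> for which the height \<open>|Im (X\<^sup>* A X)| / |X|\<^sup>2\<close> is at most that of the chord and one for
  which it is at least that. On the fibre over \<open>c\<close> the chord height times \<open>|X|\<^sup>2\<close> is
  \<open>y\<^sub>0 + \<rho>\<^sup>2 y\<^sub>1 + \<rho> L v\<close>, where \<open>y\<^sub>0\<close>, \<open>y\<^sub>1\<close> are the two heights and \<open>L\<close> is real-linear.

  \<^item> Below the chord: choose \<open>v\<close> so that the cross term \<open>x\<^sup>* A y v + v\<^sup>* y\<^sup>* A x\<close> is real.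
  Then \<open>- v\<close> has the same property, so one can also achieve \<open>L v \<ge> 0\<close>. The imaginary part
  of \<open>X\<^sup>* A X\<close> is then at most \<open>y\<^sub>0 + \<rho>\<^sup>2 y\<^sub>1\<close> in norm.

  \<^item> Above the chord: normalise \<open>x\<close> and \<open>y\<close> so that both values are complex, in the upper half plane,
  and take \<open>v = 1\<close> or \<open>v = -1\<close>. The \<open>i\<close>-component of \<open>X\<^sup>* A X\<close> is a lower bound for the
  norm of its imaginary part, and it equals the chord height times \<open>|X|\<^sup>2\<close> plus \<open>\<rho> D v\<close> with \<open>D\<close> odd, so
  that \<open>D v \<ge> 0\<close> for one of the two signs.

  Points on a common vertical line are joined by a path inside the fibre
  (lemma \<open>vertical_segment_mem\<close>).

  Geometry. If \<open>\<omega>\<close> is a star center and the line \<open>l\<close> through \<open>\<omega>\<close> and \<open>m\<close> met the interior of \<open>B\<^sup>-\<close> in \<open>z\<close>, then the segments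
  from \<open>\<omega>\<close> to points slightly to the left and right of \<open>z\<close> would give points of \<open>W \<inter> \<real>\<close> on both sides
  of \<open>m\<close>; the same applies to the line through \<open>\<omega>\<close> and \<open>M\<close>. Conversely, if a segment from \<open>\<omega>\<close> to \<open>b \<in> B\<^sup>-\<close> crosses the
  real axis to the left of \<open>m\<close>, then \<open>b\<close> and \<open>M\<close> lie on opposite sides of \<open>l\<close>, so \<open>l\<close> enters the
  interior of the triangle \<open>m\<close>, \<open>M\<close>, \<open>b\<close>, which is part of \<open>B\<^sup>-\<close>. Hence if both lines avoid the
  interior, the crossing point is in \<open>[m, M]\<close> and convexity of the two halves gives the segment.
\<close>

section \<open>Quaternions\<close>

lemma norm_quat_sq: "(norm q)\<^sup>2 = (QRe q)\<^sup>2 + (QIm1 q)\<^sup>2 + (QIm2 q)\<^sup>2 + (QIm3 q)\<^sup>2" for q :: quat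
  unfolding power2_norm_eq_inner inner_quat_def by (simp add: power2_eq_square)

lemma norm_quat_mult: "norm (p * q) = norm p * norm q" for p q :: quat
proof -
  have "(norm (p * q))\<^sup>2 = (norm p * norm q)\<^sup>2"
    by (simp add: norm_quat_sq power_mult_distrib) (simp add: power2_eq_square algebra_simps)
  then show ?thesis by (simp add: power2_eq_iff_nonneg)
qed

instance quat :: real_normed_algebra_1
proof
  show "norm (1 :: quat) = 1" by (simp add: norm_quat_def inner_quat_def)
  show "norm (p * q) \<le> norm p * norm q" for p q :: quat by (simp add: norm_quat_mult)
qed

lemma QRe_of_real [simp]: "QRe (of_real r) = r" by (simp add: of_real_quat)

lemma qcnj_mult: "qcnj (p * q) = qcnj q * qcnj p"
  and qcnj_add: "qcnj (p + q) = qcnj p + qcnj q"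
  and qcnj_scaleR: "qcnj (r *\<^sub>R q) = r *\<^sub>R qcnj q"
  by (simp_all add: quat_eq_iff algebra_simps)

lemma qcnj_qcnj: "qcnj (qcnj q) = q"
  by (simp add: quat_eq_iff)

lemma norm_qcnj: "norm (qcnj q) = norm q"
  by (simp add: norm_quat_def inner_quat_def)

lemma qcnj_mult_self: "qcnj q * q = of_real ((norm q)\<^sup>2)"
  unfolding norm_quat_sq by (simp add: of_real_quat quat_eq_iff power2_eq_square)

lemma mult_qcnj_self: "q * qcnj q = of_real ((norm q)\<^sup>2)"
  unfolding norm_quat_sq by (simp add: of_real_quat quat_eq_iff power2_eq_square)

lemma linear_qcnj: "linear qcnj"
  by (rule linearI) (simp_all add: qcnj_add qcnj_scaleR)

lemma linear_QRe: "linear QRe"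
  by (rule linearI) simp_all

lemma continuous_on_qcnj [continuous_intros]:
  "continuous_on S f \<Longrightarrow> continuous_on S (\<lambda>x. qcnj (f x))"
  using linear_qcnj linear_conv_bounded_linear bounded_linear.continuous_on by blast

lemma continuous_on_QRe [continuous_intros]:
  "continuous_on S f \<Longrightarrow> continuous_on S (\<lambda>x. QRe (f x))"
  using linear_QRe linear_conv_bounded_linear bounded_linear.continuous_on by blast

definition quat_im :: "quat \<Rightarrow> quat" where
  "quat_im q = q - of_real (QRe q)"

lemma quat_im_simps [simp]:
  "QRe (quat_im q) = 0" "QIm1 (quat_im q) = QIm1 q" "QIm2 (quat_im q) = QIm2 q" "QIm3 (quat_im q) = QIm3 q"
  by (simp_all add: quat_im_def of_real_quat)

lemma quat_im_add: "quat_im (p + q) = quat_im p + quat_im q"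
  and quat_im_scaleR: "quat_im (r *\<^sub>R q) = r *\<^sub>R quat_im q"
  by (simp_all add: quat_eq_iff)

lemma norm_quat_im_sq: "(norm (quat_im q))\<^sup>2 = (QIm1 q)\<^sup>2 + (QIm2 q)\<^sup>2 + (QIm3 q)\<^sup>2"
  by (simp add: norm_quat_sq)

lemma QIm1_le_norm_quat_im: "QIm1 q \<le> norm (quat_im q)"
  by (rule power2_le_imp_le) (simp_all add: norm_quat_im_sq)

lemma quat_im_quat_of_complex: "norm (quat_im (quat_of_complex z)) = \<bar>Im z\<bar>"
  using norm_quat_im_sq[of "quat_of_complex z"]
  by (metis power2_abs power2_eq_iff_nonneg abs_ge_zero norm_ge_zero quat_of_complex_def quat.sel add_0_right power_zero_numeral)

lemma QRe_quat_of_complex: "QRe (quat_of_complex z) = Re z"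
  by (simp add: quat_of_complex_def)

lemma QRe_conjugate: "QRe (qcnj u * q * u) = (norm u)\<^sup>2 * QRe q"
  unfolding norm_quat_sq by (simp add: power2_eq_square algebra_simps)

lemma quat_im_conjugate: "quat_im (qcnj u * q * u) = qcnj u * quat_im q * u"
  by (simp add: quat_eq_iff algebra_simps)

lemma norm_quat_im_conjugate: "norm (quat_im (qcnj u * q * u)) = (norm u)\<^sup>2 * norm (quat_im q)"
  by (simp add: quat_im_conjugate norm_quat_mult norm_qcnj power2_eq_square)

text \<open>The similarity class of a quaternion is determined by its real part and the norm of its
  imaginary part. For an imaginary \<open>p\<close> of norm \<open>|t|\<close> one has \<open>p\<^sup>2 = - t\<^sup>2\<close>, so \<open>w = p + t i\<close> satisfies
  \<open>p w = w (t i)\<close>; it vanishes only if \<open>p = - t i\<close>, and then conjugation by \<open>j\<close> works.\<close>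

lemma quat_conjugate_to_complex:
  assumes "QRe q = Re z" "norm (quat_im q) = \<bar>Im z\<bar>"
  obtains u where "norm u = 1" "qcnj u * q * u = quat_of_complex z"
proof -
  have sq: "(QIm1 q)\<^sup>2 + (QIm2 q)\<^sup>2 + (QIm3 q)\<^sup>2 = (Im z)\<^sup>2"
    using assms(2) norm_quat_im_sq[of q] by simp
  obtain w where w: "w \<noteq> 0" "q * w = w * quat_of_complex z"
  proof (cases "quat_im q + Quat 0 (Im z) 0 0 = 0")
    case True
    then have "q * Quat 0 0 1 0 = Quat 0 0 1 0 * quat_of_complex z"
      using assms(1) by (simp add: quat_eq_iff quat_of_complex_def)
    then show ?thesis by (intro that[of "Quat 0 0 1 0"]) (simp_all add: quat_eq_iff)
  next
    case False
    have "q * (quat_im q + Quat 0 (Im z) 0 0) = (quat_im q + Quat 0 (Im z) 0 0) * quat_of_complex z"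
      using assms(1) sq by (simp add: quat_eq_iff quat_of_complex_def power2_eq_square algebra_simps)
    with False show ?thesis by (intro that[of "quat_im q + Quat 0 (Im z) 0 0"]) auto
  qed
  define u where "u = w /\<^sub>R norm w"
  have nu: "norm u = 1" using w by (simp add: u_def)
  have "q * u = u * quat_of_complex z" using w by (simp add: u_def)
  then have "qcnj u * q * u = (qcnj u * u) * quat_of_complex z" by (simp add: mult.assoc)
  then have "qcnj u * q * u = quat_of_complex z" by (simp add: qcnj_mult_self nu)
  with nu show ?thesis by (rule that)
qed

section \<open>Right multiples of vectors and the form\<close>

definition rmul :: "quat ^ 'n \<Rightarrow> quat \<Rightarrow> quat ^ 'n" where
  "rmul x q = (\<chi> i. x $ i * q)"

lemma rmul_nth [simp]: "rmul x q $ i = x $ i * q" by (simp add: rmul_def)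

lemma norm_rmul: "norm (rmul x q) = norm x * norm q"
  by (simp add: norm_vec_def norm_quat_mult L2_set_left_distrib)

lemma matrix_vector_rmul: "A *v rmul x q = rmul (A *v x) q"
  by (simp add: vec_eq_iff matrix_vector_mult_def sum_distrib_right mult.assoc)

lemma hprod_rmul: "hprod (rmul x p) (rmul y q) = qcnj p * hprod x y * q"
  by (simp add: hprod_def qcnj_mult sum_distrib_left sum_distrib_right mult.assoc)

lemma hprod_add_left: "hprod (x + y) z = hprod x z + hprod y z"
  and hprod_add_right: "hprod z (x + y) = hprod z x + hprod z y"
  by (simp_all add: hprod_def qcnj_add algebra_simps sum.distrib)

definition qform :: "quat ^ 'n ^ 'n \<Rightarrow> quat ^ 'n \<Rightarrow> quat" where
  "qform A x = hprod x (A *v x)"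

lemma qform_rmul: "qform A (rmul x q) = qcnj q * qform A x * q"
  by (simp add: qform_def matrix_vector_rmul hprod_rmul)

lemma continuous_on_qform [continuous_intros]:
  "continuous_on S f \<Longrightarrow> continuous_on S (\<lambda>x. qform A (f x))"
  unfolding qform_def hprod_def matrix_vector_mult_def
  by (simp, intro continuous_intros)

lemma continuous_on_rmul [continuous_intros]:
  "continuous_on S f \<Longrightarrow> continuous_on S (\<lambda>v. rmul x (f v))"
  unfolding rmul_def by (intro continuous_intros)

text \<open>The homogeneous description of \<open>B\<close>: vectors need not be normalised, and of the imaginary part
  only the norm matters. Symmetry of \<open>B\<close> under complex conjugation is immediate from it.\<close>

lemma mem_complex_part_iff:
  "z \<in> complex_part_of (numerical_range A) \<longleftrightarrow>
    (\<exists>x. x \<noteq> 0 \<and> QRe (qform A x) = Re z * (norm x)\<^sup>2 \<and> norm (quat_im (qform A x)) = \<bar>Im z\<bar> * (norm x)\<^sup>2)"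
    (is "?L \<longleftrightarrow> ?R")
proof
  assume ?L
  then obtain x where "quat_of_complex z = qform A x" "norm x = 1"
    by (auto simp: complex_part_of_def numerical_range_def qform_def)
  then show ?R
    by (intro exI[of _ x]) (use quat_im_quat_of_complex[of z] QRe_quat_of_complex[of z] in auto)
next
  assume ?R
  then obtain x where x: "x \<noteq> 0" "QRe (qform A x) = Re z * (norm x)\<^sup>2"
    "norm (quat_im (qform A x)) = \<bar>Im z\<bar> * (norm x)\<^sup>2" by auto
  define t :: quat where "t = of_real (inverse (norm x))"
  have nt: "norm t = inverse (norm x)" by (simp add: t_def)
  have "QRe (qform A (rmul x t)) = Re z" "norm (quat_im (qform A (rmul x t))) = \<bar>Im z\<bar>"
    unfolding qform_rmul QRe_conjugate norm_quat_im_conjugate nt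
    using x by (simp_all add: field_simps)
  then obtain u where u: "norm u = 1" "qcnj u * qform A (rmul x t) * u = quat_of_complex z"
    by (rule quat_conjugate_to_complex)
  have "norm (rmul (rmul x t) u) = 1" using x u nt by (simp add: norm_rmul)
  moreover have "qform A (rmul (rmul x t) u) = quat_of_complex z" using u by (simp add: qform_rmul[of A _ u])
  ultimately show ?L
    unfolding complex_part_of_def numerical_range_def qform_def by (auto intro!: exI[of _ "rmul (rmul x t) u"])
qed

lemma compact_numerical_range: "compact (numerical_range A)"
proof -
  have "numerical_range A = qform A ` sphere 0 1"
    by (auto simp: numerical_range_def qform_def)
  then show ?thesis
    by (simp add: compact_continuous_image continuous_intros)
qed


section \<open>Convexity of the upper half\<close>

text \<open>The mixed part of the form at \<open>x + y v\<close>; it is real-linear in \<open>v\<close>.\<close>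

definition cross_term :: "quat ^ 'n ^ 'n \<Rightarrow> quat ^ 'n \<Rightarrow> quat ^ 'n \<Rightarrow> quat \<Rightarrow> quat" where
  "cross_term A x y v = hprod x (A *v y) * v + qcnj v * hprod y (A *v x)"

lemma cross_term_minus: "cross_term A x y (- v) = - cross_term A x y v"
  by (simp add: cross_term_def quat_eq_iff)

lemma hprod_scaleR_left: "hprod (a *\<^sub>R x) y = a *\<^sub>R hprod x y"
  and hprod_scaleR_right: "hprod x (a *\<^sub>R y) = a *\<^sub>R hprod x y"
  by (simp_all add: hprod_def qcnj_scaleR scaleR_sum_right)

lemma matrix_vector_scaleR: "A *v (a *\<^sub>R x) = a *\<^sub>R (A *v x)" for A :: "quat ^ 'n ^ 'm"
  by (simp add: vec_eq_iff matrix_vector_mult_def scaleR_sum_right)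

lemma rmul_scaleR: "rmul x (a *\<^sub>R q) = a *\<^sub>R rmul x q"
  by (simp add: vec_eq_iff)

lemma hprod_rmul_left: "hprod (rmul x p) y = qcnj p * hprod x y"
  and hprod_rmul_right: "hprod x (rmul y q) = hprod x y * q"
  by (simp_all add: hprod_def qcnj_mult sum_distrib_left sum_distrib_right mult.assoc)

lemma qform_combination:
  "qform A (a *\<^sub>R x + rmul y (b *\<^sub>R v)) =
    a\<^sup>2 *\<^sub>R qform A x + b\<^sup>2 *\<^sub>R (qcnj v * qform A y * v) + (a * b) *\<^sub>R cross_term A x y v"
  unfolding qform_def cross_term_def
  by (simp add: matrix_vector_right_distrib matrix_vector_rmul matrix_vector_scaleR rmul_scaleR
      hprod_add_left hprod_add_right hprod_scaleR_left hprod_scaleR_right hprod_rmul_left hprod_rmul_right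
      distrib_left distrib_right scaleR_right_distrib power2_eq_square mult.assoc mult.commute[of b a])

lemma qcnj_hprod: "qcnj (hprod x y) = hprod y x"
  unfolding hprod_def linear_sum[OF linear_qcnj] by (simp add: qcnj_mult qcnj_qcnj)

lemma norm_sq_hprod: "(norm x)\<^sup>2 = QRe (hprod x x)"
  unfolding hprod_self by (rule QRe_of_real[symmetric])

lemma norm_sq_combination:
  "(norm (a *\<^sub>R x + rmul y (b *\<^sub>R v)))\<^sup>2 =
    a\<^sup>2 * (norm x)\<^sup>2 + b\<^sup>2 * ((norm v)\<^sup>2 * (norm y)\<^sup>2) + a * b * (2 * QRe (hprod x y * v))"
proof -
  have conj: "(norm v)\<^sup>2 * QRe (hprod y y) = QRe (qcnj v * hprod y y * v)"
    by (rule QRe_conjugate[symmetric])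
  have "hprod y x = qcnj (hprod x y)" by (simp add: qcnj_hprod)
  then have cross: "QRe (qcnj v * hprod y x) = QRe (hprod x y * v)"
    by (simp flip: qcnj_mult)
  show ?thesis
    unfolding norm_sq_hprod[of x] norm_sq_hprod[of y] norm_sq_hprod[of "_ + _"] conj
    by (simp add: rmul_scaleR hprod_add_left hprod_add_right hprod_scaleR_left hprod_scaleR_right
        hprod_rmul_left hprod_rmul_right cross mult.assoc power2_eq_square algebra_simps del: times_quat.simps)
qed

text \<open>If \<open>x\<close> were a right multiple of \<open>y\<close>, the two values of the form would be similar, and
  similar complex numbers in the upper half plane are equal.\<close>

lemma combination_nonzero:
  assumes "norm x = 1" "norm y = 1"
    and Qx: "qform A x = quat_of_complex z0" and Qy: "qform A y = quat_of_complex z1"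
    and "Im z0 \<ge> 0" "Im z1 \<ge> 0" "z0 \<noteq> z1" and "a \<noteq> 0"
  shows "a *\<^sub>R x + rmul y q \<noteq> 0"
proof
  assume 0: "a *\<^sub>R x + rmul y q = 0"
  define p where "p = (- inverse a) *\<^sub>R q"
  have "x = inverse a *\<^sub>R (a *\<^sub>R x)" using \<open>a \<noteq> 0\<close> by simp
  also have "a *\<^sub>R x = - rmul y q" using 0 by (simp only: eq_neg_iff_add_eq_0)
  also have "inverse a *\<^sub>R (- rmul y q) = rmul y p" by (simp add: vec_eq_iff p_def)
  finally have x: "x = rmul y p" .
  then have "norm p = 1" using assms(1,2) by (simp add: norm_rmul)
  have Qp: "quat_of_complex z0 = qcnj p * quat_of_complex z1 * p"
    using Qx Qy x by (simp only: qform_rmul)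
  have "Re z0 = Re z1"
    using QRe_conjugate[of p "quat_of_complex z1"] \<open>norm p = 1\<close>
    unfolding Qp[symmetric] QRe_quat_of_complex by simp
  moreover have "\<bar>Im z0\<bar> = \<bar>Im z1\<bar>"
    using norm_quat_im_conjugate[of p "quat_of_complex z1"] \<open>norm p = 1\<close>
    unfolding Qp[symmetric] quat_im_quat_of_complex by simp
  ultimately show False using assms(5-7) by (simp add: complex_eq_iff)
qed

lemma ex_unit_mult_real: "\<exists>v. norm v = 1 \<and> quat_im (p * v) = 0"
proof (cases "p = 0")
  case True
  then show ?thesis by (intro exI[of _ 1]) (simp add: quat_eq_iff)
next
  case False
  have "p * (qcnj p /\<^sub>R norm p) = of_real (norm p)"
    using False by (simp add: mult_qcnj_self power2_eq_square) (simp add: of_real_def)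
  with False show ?thesis
    by (intro exI[of _ "qcnj p /\<^sub>R norm p"]) (simp add: norm_qcnj quat_im_def)
qed

text \<open>Up to a real summand, the cross term is the product of one fixed quaternion with \<open>v\<close>.\<close>

lemma ex_unit_real_cross_term: "\<exists>v. norm v = 1 \<and> quat_im (cross_term A x y v) = 0"
proof -
  obtain v where v: "norm v = 1" "quat_im ((hprod x (A *v y) - qcnj (hprod y (A *v x))) * v) = 0"
    using ex_unit_mult_real by blast
  have "quat_im (cross_term A x y v) = quat_im ((hprod x (A *v y) - qcnj (hprod y (A *v x))) * v)"
    by (simp add: cross_term_def quat_eq_iff algebra_simps)
  with v show ?thesis by auto
qed

text \<open>Multiplying a real number \<open>p v\<close> by \<open>i\<close> makes it purely imaginary.\<close>

lemma ex_unit_orthogonal: "\<exists>v :: quat. norm v = 1 \<and> QRe (p * v) = 0"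
proof -
  obtain v where v: "norm v = 1" "quat_im (p * v) = 0" using ex_unit_mult_real by blast
  have "norm (v * Quat 0 1 0 0) = 1"
    unfolding norm_quat_mult v(1) by (simp add: norm_quat_def inner_quat_def)
  moreover have "QRe (p * (v * Quat 0 1 0 0)) = - QIm1 (p * v)"
    by (simp add: algebra_simps)
  moreover have "QIm1 (p * v) = 0"
    using arg_cong[OF v(2), of QIm1] by simp
  ultimately show ?thesis by (intro exI[of _ "v * Quat 0 1 0 0"]) simp
qed

lemma DIM_quat: "DIM(quat) = 4"
proof -
  have one: "(1 :: quat) = Quat 1 0 0 0" by (simp add: quat_eq_iff)
  show ?thesis by (simp add: Basis_quat_def one)
qed

lemma connected_real_ivt:
  fixes f :: "'a :: topological_space \<Rightarrow> real"
  assumes "connected S" "continuous_on S f" "a \<in> S" "b \<in> S" "f a \<le> 0" "0 \<le> f b"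
  obtains s where "s \<in> S" "f s = 0"
proof -
  have "connected (f ` S)" using assms by (intro connected_continuous_image)
  then have "0 \<in> f ` S"
    using assms connectedD_interval[of "f ` S" "f a" "f b" 0] by blast
  then show ?thesis using that by auto
qed

text \<open>The intermediate value argument over the sphere of unit quaternions \<open>v\<close>. Here \<open>(c, h)\<close> is the
  point of the chord, \<open>\<rho> v\<close> is the radius that puts \<open>X v\<close> into the fibre over \<open>c\<close>, and \<open>F v\<close>
  measures by how much \<open>X v\<close> is above the chord.\<close>

lemma sloped_segment_mem:
  assumes z0: "z0 \<in> complex_part_of (numerical_range A)" "Im z0 \<ge> 0"
    and z1: "z1 \<in> complex_part_of (numerical_range A)" "Im z1 \<ge> 0"
    and less: "Re z0 < Re z1" and t: "0 < t" "t < 1"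
  shows "(1 - t) *\<^sub>R z0 + t *\<^sub>R z1 \<in> complex_part_of (numerical_range A)"
proof -
  obtain x where x: "norm x = 1" and Qx: "qform A x = quat_of_complex z0"
    using z0 by (auto simp: complex_part_of_def numerical_range_def qform_def)
  obtain y where y: "norm y = 1" and Qy: "qform A y = quat_of_complex z1"
    using z1 by (auto simp: complex_part_of_def numerical_range_def qform_def)
  define c where "c = (1 - t) * Re z0 + t * Re z1"
  define h where "h = (1 - t) * Im z0 + t * Im z1"
  define \<alpha> \<beta> where "\<alpha> = c - Re z0" and "\<beta> = Re z1 - c"
  have ab: "\<alpha> = t * (Re z1 - Re z0)" "\<beta> = (1 - t) * (Re z1 - Re z0)"
    by (simp_all add: \<alpha>_def \<beta>_def c_def algebra_simps)
  then have pos: "\<alpha> > 0" "\<beta> > 0" using less t by simp_all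
  \<comment> \<open>\<open>C\<close> and \<open>G\<close> are the mixed parts of the real part of the form and of the squared norm;
    \<open>\<kappa>\<close> is the slope of the chord.\<close>
  define C where "C v = QRe (cross_term A x y v)" for v
  define G where "G v = 2 * QRe (hprod x y * v)" for v
  define \<kappa> where "\<kappa> = (Im z1 - Im z0) / (Re z1 - Re z0)"
  define L where "L v = Im z0 * G v + \<kappa> * (C v - Re z0 * G v)" for v
  define \<tau> where "\<tau> v = C v - c * G v" for v
  define \<rho> where "\<rho> v = (sqrt ((\<tau> v)\<^sup>2 + 4 * \<alpha> * \<beta>) - \<tau> v) / (2 * \<beta>)" for v
  have \<rho>_pos: "\<rho> v > 0" for v
  proof -
    have "\<bar>\<tau> v\<bar> < sqrt ((\<tau> v)\<^sup>2 + 4 * \<alpha> * \<beta>)" using pos by (intro real_less_rsqrt) simp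
    then show ?thesis using pos by (simp add: \<rho>_def)
  qed
  have \<rho>_root: "\<beta> * (\<rho> v)\<^sup>2 + \<tau> v * \<rho> v = \<alpha>" for v
  proof -
    define S where "S = sqrt ((\<tau> v)\<^sup>2 + 4 * \<alpha> * \<beta>)"
    have S: "S\<^sup>2 = (\<tau> v)\<^sup>2 + 4 * \<alpha> * \<beta>" unfolding S_def using pos by simp
    have "\<rho> v * (2 * \<beta>) = S - \<tau> v" using pos by (simp add: \<rho>_def S_def)
    then have "4 * \<beta> * (\<beta> * (\<rho> v)\<^sup>2 + \<tau> v * \<rho> v) = (S - \<tau> v)\<^sup>2 + 2 * \<tau> v * (S - \<tau> v)"
      by (simp add: power2_eq_square algebra_simps flip: \<open>\<rho> v * (2 * \<beta>) = S - \<tau> v\<close>)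
    also have "\<dots> = 4 * \<beta> * \<alpha>" using S by (simp add: power2_eq_square algebra_simps)
    finally show ?thesis using pos by simp
  qed
  define X where "X v = 1 *\<^sub>R x + rmul y (\<rho> v *\<^sub>R v)" for v
  have QX: "qform A (X v) = quat_of_complex z0 + (\<rho> v)\<^sup>2 *\<^sub>R (qcnj v * quat_of_complex z1 * v)
      + \<rho> v *\<^sub>R cross_term A x y v" for v
    unfolding X_def qform_combination Qx Qy by simp
  have NX: "(norm (X v))\<^sup>2 = 1 + (\<rho> v)\<^sup>2 + \<rho> v * G v" if "norm v = 1" for v
    unfolding X_def norm_sq_combination G_def using that x y by simp
  have RX: "QRe (qform A (X v)) = Re z0 + (\<rho> v)\<^sup>2 * Re z1 + \<rho> v * C v" if "norm v = 1" for v
    unfolding QX using QRe_conjugate[of v "quat_of_complex z1"] that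
    by (simp add: C_def QRe_quat_of_complex del: times_quat.simps)
  have fibre: "QRe (qform A (X v)) = c * (norm (X v))\<^sup>2" if "norm v = 1" for v
    using \<rho>_root[of v] unfolding RX[OF that] NX[OF that] \<alpha>_def \<beta>_def \<tau>_def by (simp add: algebra_simps)
  have level: "h * (norm (X v))\<^sup>2 = Im z0 + (\<rho> v)\<^sup>2 * Im z1 + \<rho> v * L v" if "norm v = 1" for v
  proof -
    have k: "\<kappa> * (Re z1 - Re z0) = Im z1 - Im z0" using less by (simp add: \<kappa>_def)
    have "h = Im z0 + t * (\<kappa> * (Re z1 - Re z0))" unfolding k by (simp add: h_def algebra_simps)
    also have "\<dots> = Im z0 + \<kappa> * (c - Re z0)" using ab by (simp add: \<alpha>_def)
    finally have h: "h = Im z0 + \<kappa> * (c - Re z0)" .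
    have "h * (norm (X v))\<^sup>2 = Im z0 * (norm (X v))\<^sup>2 + \<kappa> * (QRe (qform A (X v)) - Re z0 * (norm (X v))\<^sup>2)"
      unfolding fibre[OF that] h by (simp add: algebra_simps)
    also have "\<dots> = Im z0 + (\<rho> v)\<^sup>2 * (Im z0 + \<kappa> * (Re z1 - Re z0)) + \<rho> v * L v"
      unfolding RX[OF that] NX[OF that] L_def by (simp add: algebra_simps)
    finally show ?thesis unfolding k by simp
  qed
  define F where "F v = norm (quat_im (qform A (X v))) - h * (norm (X v))\<^sup>2" for v
  have L_minus: "L (- v) = - L v" for v
    by (simp add: L_def C_def G_def cross_term_minus algebra_simps)
  \<comment> \<open>A real cross term leaves only the two pure terms in the imaginary part.\<close>
  have low: "\<exists>v. norm v = 1 \<and> F v \<le> 0"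
  proof -
    obtain v0 where v0: "norm v0 = 1" "quat_im (cross_term A x y v0) = 0"
      using ex_unit_real_cross_term by blast
    obtain v where v: "norm v = 1" "quat_im (cross_term A x y v) = 0" "L v \<ge> 0"
    proof (cases "L v0 \<ge> 0")
      case True
      with v0 show ?thesis by (intro that)
    next
      case False
      with v0 show ?thesis
        by (intro that[of "- v0"]) (simp_all add: L_minus cross_term_minus quat_eq_iff)
    qed
    have "quat_im (qform A (X v)) = quat_im (quat_of_complex z0) + (\<rho> v)\<^sup>2 *\<^sub>R quat_im (qcnj v * quat_of_complex z1 * v)"
      unfolding QX quat_im_add quat_im_scaleR v(2) by simp
    also have "norm \<dots> \<le> Im z0 + (\<rho> v)\<^sup>2 * Im z1"
      by (rule order_trans[OF norm_triangle_ineq])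
        (use z0 z1 v in \<open>simp add: norm_quat_im_conjugate quat_im_quat_of_complex\<close>)
    finally have "F v \<le> 0"
      unfolding F_def level[OF v(1)] using v(3) \<rho>_pos[of v] by (simp add: add_increasing2)
    with v show ?thesis by blast
  qed
  \<comment> \<open>For \<open>v = 1\<close> and \<open>v = -1\<close> the pure terms both point in the direction \<open>i\<close>, so their
    norms add up without loss.\<close>
  have high: "\<exists>v. norm v = 1 \<and> 0 \<le> F v"
  proof -
    define D where "D v = QIm1 (cross_term A x y v) - L v" for v
    obtain v where v: "v = 1 \<or> v = - 1" "D v \<ge> 0"
    proof (cases "D 1 \<ge> 0")
      case False
      then show ?thesis by (intro that[of "- 1"]) (simp_all add: D_def L_minus cross_term_minus)
    qed (intro that, auto)
    have nv: "norm v = 1" using v by auto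
    have conj: "qcnj v * q * v = q" for q using v(1) by (auto simp: quat_eq_iff)
    have "QIm1 (qform A (X v)) = Im z0 + (\<rho> v)\<^sup>2 * Im z1 + \<rho> v * QIm1 (cross_term A x y v)"
      unfolding QX conj by (simp add: quat_of_complex_def)
    then have "QIm1 (qform A (X v)) - h * (norm (X v))\<^sup>2 = \<rho> v * D v"
      unfolding level[OF nv] D_def by (simp add: algebra_simps)
    moreover have "\<rho> v * D v \<ge> 0" using v(2) \<rho>_pos[of v] by simp
    ultimately have "0 \<le> F v" unfolding F_def using QIm1_le_norm_quat_im[of "qform A (X v)"] by linarith
    with nv show ?thesis by blast
  qed
  have cont: "continuous_on (sphere 0 1) F"
    unfolding F_def X_def \<rho>_def \<tau>_def C_def G_def cross_term_def quat_im_def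
    using pos by (intro continuous_intros) auto
  have conn: "connected (sphere (0 :: quat) 1)"
    by (rule connected_sphere) (simp add: DIM_quat)
  from low high obtain v1 v2 where "v1 \<in> sphere 0 1" "v2 \<in> sphere 0 1" "F v1 \<le> 0" "0 \<le> F v2"
    by auto
  then obtain v where "v \<in> sphere 0 1" and F: "F v = 0"
    by (rule connected_real_ivt[OF conn cont])
  then have v: "norm v = 1" by simp
  have "X v \<noteq> 0"
    unfolding X_def using less z0 z1 by (intro combination_nonzero[OF x y Qx Qy]) auto
  moreover have "\<bar>h\<bar> = h" using z0 z1 t by (simp add: h_def)
  moreover have "(1 - t) *\<^sub>R z0 + t *\<^sub>R z1 = Complex c h" by (simp add: complex_eq_iff c_def h_def)
  ultimately show ?thesis
    unfolding mem_complex_part_iff using F fibre[OF v] unfolding F_def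
    by (intro exI[of _ "X v"]) simp
qed

text \<open>With equal abscissae the equation for \<open>\<rho>\<close> degenerates, and the fibre is entered differently:
  \<open>v\<close> is chosen so that the mixed terms of \<open>Re (X\<^sup>* A X)\<close> and \<open>c |X|\<^sup>2\<close> agree. Then
  every real combination of \<open>x\<close> and \<open>y v\<close> lies over \<open>c\<close>, and the height varies continuously from one
  end to the other.\<close>

lemma vertical_segment_mem:
  assumes z0: "z0 \<in> complex_part_of (numerical_range A)" "Im z0 \<ge> 0"
    and z1: "z1 \<in> complex_part_of (numerical_range A)"
    and eq: "Re z0 = c" "Re z1 = c" and h: "Im z0 < h" "h < Im z1"
  shows "Complex c h \<in> complex_part_of (numerical_range A)"
proof -
  obtain x where x: "norm x = 1" and Qx: "qform A x = quat_of_complex z0"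
    using z0 by (auto simp: complex_part_of_def numerical_range_def qform_def)
  obtain y where y: "norm y = 1" and Qy: "qform A y = quat_of_complex z1"
    using z1 by (auto simp: complex_part_of_def numerical_range_def qform_def)
  obtain v where v: "norm v = 1"
    "QRe ((hprod x (A *v y) + qcnj (hprod y (A *v x)) - (2 * c) *\<^sub>R hprod x y) * v) = 0"
    using ex_unit_orthogonal by blast
  then have cross: "QRe (cross_term A x y v) = c * (2 * QRe (hprod x y * v))"
    by (simp add: cross_term_def algebra_simps)
  define X where "X t = (1 - t) *\<^sub>R x + rmul y (t *\<^sub>R v)" for t :: real
  have fibre: "QRe (qform A (X t)) = c * (norm (X t))\<^sup>2" for t
    unfolding X_def qform_combination norm_sq_combination Qx Qy
    using QRe_conjugate[of v "quat_of_complex z1"] v(1) x y eq cross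
    by (simp add: QRe_quat_of_complex algebra_simps del: times_quat.simps)
  define F where "F t = norm (quat_im (qform A (X t))) - h * (norm (X t))\<^sup>2" for t
  have X01: "X 0 = x" "X 1 = rmul y v" by (simp_all add: X_def vec_eq_iff)
  have F0: "F 0 < 0"
    using z0 h x by (simp add: F_def X01 Qx quat_im_quat_of_complex)
  have F1: "F 1 > 0"
    using z0 h y v by (simp add: F_def X01 qform_rmul Qy norm_quat_im_conjugate norm_rmul quat_im_quat_of_complex)
  have cont: "continuous_on {0..1} F"
    unfolding F_def X_def quat_im_def by (intro continuous_intros)
  obtain t where t: "t \<in> {0..1}" "F t = 0"
    by (rule connected_real_ivt[OF connected_Icc cont, of 0 1]) (use F0 F1 in simp_all)
  with F1 have "t \<noteq> 1" by auto
  then have "X t \<noteq> 0"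
    unfolding X_def using z0 h by (intro combination_nonzero[OF x y Qx Qy]) auto
  then show ?thesis
    unfolding mem_complex_part_iff using t(2) fibre[of t] z0 h unfolding F_def
    by (intro exI[of _ "X t"]) simp
qed

lemma convex_upper_complex_part:
  "convex (complex_part_of (numerical_range A) \<inter> {z. Im z \<ge> 0})"
proof -
  let ?B = "complex_part_of (numerical_range A)"
  have main: "(1 - t) *\<^sub>R z0 + t *\<^sub>R z1 \<in> ?B"
    if "z0 \<in> ?B" "z1 \<in> ?B" "Im z0 \<ge> 0" "Im z1 \<ge> 0" "0 < t" "t < 1"
      and le: "Re z0 < Re z1 \<or> Re z0 = Re z1 \<and> Im z0 \<le> Im z1" for z0 z1 t
  proof -
    consider "Re z0 < Re z1" | "Re z0 = Re z1" "Im z0 < Im z1" | "z0 = z1"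
      using le complex_eqI[of z0 z1] by linarith
    then show ?thesis
    proof cases
      case 1
      with that show ?thesis by (intro sloped_segment_mem)
    next
      case 2
      define h where "h = (1 - t) * Im z0 + t * Im z1"
      have "0 < t * (Im z1 - Im z0)" "0 < (1 - t) * (Im z1 - Im z0)"
        using 2(2) \<open>0 < t\<close> \<open>t < 1\<close> by simp_all
      then have h: "Im z0 < h" "h < Im z1" by (simp_all add: h_def algebra_simps)
      have "Complex (Re z0) h \<in> ?B"
        by (rule vertical_segment_mem[OF \<open>z0 \<in> ?B\<close> \<open>Im z0 \<ge> 0\<close> \<open>z1 \<in> ?B\<close> refl 2(1)[symmetric] h])
      also have "Complex (Re z0) h = (1 - t) *\<^sub>R z0 + t *\<^sub>R z1"
        using 2(1) by (simp add: complex_eq_iff h_def algebra_simps)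
      finally show ?thesis .
    next
      case 3
      then have "(1 - t) *\<^sub>R z0 + t *\<^sub>R z1 = z0" by simp
      with \<open>z0 \<in> ?B\<close> show ?thesis by simp
    qed
  qed
  show ?thesis
    unfolding convex_alt
  proof (intro ballI allI impI)
    fix z0 z1 and t :: real
    assume "z0 \<in> ?B \<inter> {z. Im z \<ge> 0}" "z1 \<in> ?B \<inter> {z. Im z \<ge> 0}" and t: "0 \<le> t \<and> t \<le> 1"
    then have z: "z0 \<in> ?B" "z1 \<in> ?B" "Im z0 \<ge> 0" "Im z1 \<ge> 0" by simp_all
    consider "t = 0" | "t = 1" | "0 < t" "t < 1" using t by linarith
    then have "(1 - t) *\<^sub>R z0 + t *\<^sub>R z1 \<in> ?B"
    proof cases
      case 3
      then have t': "0 < 1 - t" "1 - t < 1" by simp_all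
      show ?thesis
      proof (cases "Re z0 < Re z1 \<or> Re z0 = Re z1 \<and> Im z0 \<le> Im z1")
        case True
        then show ?thesis by (rule main[OF z 3])
      next
        case False
        then have "Re z1 < Re z0 \<or> Re z1 = Re z0 \<and> Im z1 \<le> Im z0" by linarith
        then have "(1 - (1 - t)) *\<^sub>R z1 + (1 - t) *\<^sub>R z0 \<in> ?B"
          by (rule main[OF z(2,1,4,3) t'])
        then show ?thesis by (simp add: add.commute)
      qed
    qed (use z in simp_all)
    with z t show "(1 - t) *\<^sub>R z0 + t *\<^sub>R z1 \<in> ?B \<inter> {z. Im z \<ge> 0}" by simp
  qed
qed

lemma cnj_mem_complex_part:
  "z \<in> complex_part_of (numerical_range A) \<Longrightarrow> cnj z \<in> complex_part_of (numerical_range A)"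
  by (simp add: mem_complex_part_iff)

lemma of_real_mem_complex_part_iff: "of_real r \<in> complex_part_of W \<longleftrightarrow> r \<in> real_part_of W"
  by (simp add: complex_part_of_def real_part_of_def quat_of_complex_def of_real_quat)

lemma compact_real_part: "compact (real_part_of (numerical_range A))"
proof -
  have "closed (real_part_of (numerical_range A))"
    unfolding real_part_of_def using compact_imp_closed[OF compact_numerical_range[of A]]
    by (intro closed_vimage[unfolded vimage_def] continuous_intros)
  moreover have "bounded (real_part_of (numerical_range A))"
  proof -
    have "real_part_of (numerical_range A) \<subseteq> QRe ` numerical_range A"
      by (force simp: real_part_of_def)
    moreover have "bounded (QRe ` numerical_range A)"
      by (intro compact_imp_bounded compact_continuous_image compact_numerical_range continuous_intros)
    ultimately show ?thesis by (rule bounded_subset[rotated])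
  qed
  ultimately show ?thesis by (simp add: compact_eq_bounded_closed)
qed

text \<open>For the empty set both descriptions are \<open>THE x. False\<close>, so the strict inequality alone
  excludes it.\<close>

lemma Least_less_Greatest_imp_extrema:
  fixes R :: "real set"
  assumes "compact R" and "(LEAST r. r \<in> R) < (GREATEST r. r \<in> R)"
  shows "(LEAST r. r \<in> R) \<in> R" "(GREATEST r. r \<in> R) \<in> R"
    and "r \<in> R \<Longrightarrow> (LEAST r. r \<in> R) \<le> r" "r \<in> R \<Longrightarrow> r \<le> (GREATEST r. r \<in> R)"
proof -
  have "R \<noteq> {}"
  proof
    assume "R = {}"
    then have "(LEAST r. r \<in> R) = (GREATEST r. r \<in> R)"
      by (simp add: Least_def Greatest_def)
    with assms(2) show False by simp
  qed
  obtain a where a: "a \<in> R" "\<forall>r\<in>R. a \<le> r"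
    using compact_attains_inf[OF assms(1) \<open>R \<noteq> {}\<close>] by blast
  obtain b where b: "b \<in> R" "\<forall>r\<in>R. r \<le> b"
    using compact_attains_sup[OF assms(1) \<open>R \<noteq> {}\<close>] by blast
  have "(LEAST r. r \<in> R) = a" using a by (intro Least_equality) auto
  moreover have "(GREATEST r. r \<in> R) = b" using b by (intro Greatest_equality) auto
  ultimately show "(LEAST r. r \<in> R) \<in> R" "(GREATEST r. r \<in> R) \<in> R"
    "r \<in> R \<Longrightarrow> (LEAST r. r \<in> R) \<le> r" "r \<in> R \<Longrightarrow> r \<le> (GREATEST r. r \<in> R)"
    using a b by auto
qed

section \<open>Plane geometry of the star-center\<close>

text \<open>The segment from \<open>\<omega>\<close> to \<open>z\<close> crosses the axis at \<open>c\<close>. Moving \<open>z\<close> horizontally by \<open>d\<close> moves the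
  crossing point by \<open>s d\<close>, where \<open>s > 0\<close> is the crossing parameter.\<close>

lemma star_center_line_meets_interior:
  assumes star: "\<omega> \<in> star_center B" and \<omega>: "Im \<omega> > 0"
    and z: "z \<in> line_to_real \<omega> c" "z \<in> interior (B \<inter> {z. Im z \<le> 0})"
  shows "\<exists>\<delta>>0. of_real (c - \<delta>) \<in> B \<and> of_real (c + \<delta>) \<in> B"
proof -
  obtain e where e: "e > 0" "cball z e \<subseteq> B \<inter> {z. Im z \<le> 0}"
    using z(2) by (auto simp only: mem_interior_cball)
  have "z + e *\<^sub>R \<i> \<in> cball z e" using e by (simp add: dist_norm)
  with e have Imz: "Im z < 0" by fastforce
  define s where "s = Im \<omega> / (Im \<omega> - Im z)"
  have s: "0 < s" "s < 1" using \<omega> Imz by (simp_all add: s_def)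
  have cross: "(1 - s) *\<^sub>R \<omega> + s *\<^sub>R z = of_real c"
  proof -
    have sI: "s * (Im \<omega> - Im z) = Im \<omega>" using \<omega> Imz by (simp add: s_def)
    define k where "k = (Re \<omega> - c) / Im \<omega>"
    have k: "Re \<omega> = k * Im \<omega> + c" using \<omega> by (simp add: k_def)
    have Rz: "Re z = k * Im z + c" using z(1) by (simp add: line_to_real_def k_def)
    have "(1 - s) * Re \<omega> + s * Re z = k * (Im \<omega> - s * (Im \<omega> - Im z)) + c"
      unfolding k Rz by (simp add: algebra_simps)
    with sI show ?thesis by (simp add: complex_eq_iff algebra_simps)
  qed
  have "of_real (c + s * d) \<in> B" if "\<bar>d\<bar> = e" for d
  proof -
    have "z + of_real d \<in> cball z e" using that by (simp add: dist_norm)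
    with e have "z + of_real d \<in> B" by blast
    with star s have "(1 - s) *\<^sub>R \<omega> + s *\<^sub>R (z + of_real d) \<in> B"
      unfolding star_center_def by auto
    also have "(1 - s) *\<^sub>R \<omega> + s *\<^sub>R (z + of_real d) = of_real c + of_real (s * d)"
      unfolding cross[symmetric] by (simp add: scaleR_conv_of_real distrib_left)
    finally show ?thesis by simp
  qed
  from this[of e] this[of "- e"] e s show ?thesis
    by (intro exI[of _ "s * e"]) simp
qed

text \<open>A line through the vertex \<open>c\<close> of the triangle \<open>c\<close>, \<open>d\<close>, \<open>b\<close> that separates the other two vertices
  meets the opposite side, and so passes through the interior. The function
  \<open>Re z - k Im z - c\<close> takes the values \<open>0\<close>, \<open>d - c\<close>, \<open>g\<close> at the vertices; the point with weights
  \<open>1/2\<close>, \<open>\<epsilon> |g|\<close>, \<open>\<epsilon> |d - c|\<close> is a zero of it, as \<open>d - c\<close> and \<open>g\<close> have opposite signs.\<close>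

lemma line_meets_triangle_interior:
  assumes K: "convex K" "of_real c \<in> K" "of_real d \<in> K" "b \<in> K" and b: "Im b < 0"
    and opposite: "(d - c) * (Re b - k * Im b - c) < 0"
  shows "\<exists>z \<in> interior K. Re z = k * Im z + c"
proof -
  define g where "g = Re b - k * Im b - c"
  have opp: "(d - c) * g < 0" using opposite by (simp add: g_def)
  then have dc: "d \<noteq> c" and g: "g \<noteq> 0" by auto
  have size: "\<bar>d - c\<bar> + \<bar>g\<bar> > 0" using dc by (simp add: add_pos_nonneg)
  define \<epsilon> where "\<epsilon> = 1 / (2 * (\<bar>d - c\<bar> + \<bar>g\<bar>))"
  have sum: "\<epsilon> * (\<bar>d - c\<bar> + \<bar>g\<bar>) = 1 / 2" using size by (simp add: \<epsilon>_def field_simps)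
  have "\<epsilon> > 0" using size by (simp add: \<epsilon>_def)
  have bal: "\<bar>g\<bar> * (d - c) + \<bar>d - c\<bar> * g = 0"
    using opp unfolding mult_less_0_iff by (elim disjE conjE) (simp_all add: algebra_simps)
  define z where "z = (1 / 2) *\<^sub>R complex_of_real c + (\<epsilon> * \<bar>g\<bar>) *\<^sub>R complex_of_real d + (\<epsilon> * \<bar>d - c\<bar>) *\<^sub>R b"
  have nc: "\<not> collinear {of_real c, of_real d, b}"
  proof
    assume "collinear {of_real c, of_real d, b}"
    then have "b \<in> affine hull {complex_of_real c, complex_of_real d}"
      using dc by (simp add: collinear_3_affine_hull)
    then show False using b by (auto simp: affine_hull_2)
  qed
  have weights: "0 < \<epsilon> * \<bar>g\<bar>" "0 < \<epsilon> * \<bar>d - c\<bar>" "1 / 2 + \<epsilon> * \<bar>g\<bar> + \<epsilon> * \<bar>d - c\<bar> = 1"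
    using \<open>\<epsilon> > 0\<close> dc g sum by (simp_all add: distrib_left)
  have "z \<in> interior (convex hull {of_real c, of_real d, b})"
    unfolding interior_convex_hull_3_minimal[OF nc DIM_complex]
    by (intro CollectI exI conjI) (rule half_gt_zero[OF zero_less_one] weights z_def[symmetric])+
  moreover have "convex hull {of_real c, of_real d, b} \<subseteq> K"
    using K by (intro hull_minimal) auto
  ultimately have "z \<in> interior K" using interior_mono by blast
  moreover have "Re z - k * Im z - c = 0"
  proof -
    have "Re z - k * Im z - c = (\<epsilon> * \<bar>g\<bar> * (d - c) + \<epsilon> * \<bar>d - c\<bar> * g) + c * (\<epsilon> * (\<bar>d - c\<bar> + \<bar>g\<bar>) - 1 / 2)"
      unfolding z_def g_def by (simp add: algebra_simps)
    also have "\<dots> = \<epsilon> * (\<bar>g\<bar> * (d - c) + \<bar>d - c\<bar> * g)" unfolding sum by (simp add: algebra_simps)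
    finally show ?thesis by (simp add: bal)
  qed
  ultimately show ?thesis by (intro bexI[of _ z]) auto
qed

lemma star_center_if_lines_avoid_interior:
  assumes up: "convex (B \<inter> {z. Im z \<ge> 0})" and low: "convex (B \<inter> {z. Im z \<le> 0})"
    and ends: "of_real m \<in> B" "of_real M \<in> B" "m < M"
    and \<omega>: "\<omega> \<in> B" "Im \<omega> > 0"
    and avoid: "line_to_real \<omega> m \<inter> interior (B \<inter> {z. Im z \<le> 0}) = {}"
      "line_to_real \<omega> M \<inter> interior (B \<inter> {z. Im z \<le> 0}) = {}"
  shows "\<omega> \<in> star_center B"
proof -
  have "closed_segment \<omega> b \<subseteq> B" if b: "b \<in> B" for b
  proof (cases "Im b \<ge> 0")
    case True
    then have "closed_segment \<omega> b \<subseteq> B \<inter> {z. Im z \<ge> 0}"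
      using up \<omega> b by (intro closed_segment_subset) auto
    then show ?thesis by blast
  next
    case False
    then have Imb: "Im b < 0" by simp
    define s where "s = Im \<omega> / (Im \<omega> - Im b)"
    have s: "0 < s" "s < 1" using \<omega> Imb by (simp_all add: s_def)
    define p where "p = (1 - s) * Re \<omega> + s * Re b"
    have sI: "s * (Im \<omega> - Im b) = Im \<omega>" using \<omega> Imb by (simp add: s_def)
    then have p: "of_real p = (1 - s) *\<^sub>R \<omega> + s *\<^sub>R b"
      by (simp add: complex_eq_iff p_def algebra_simps)
    \<comment> \<open>The crossing point \<open>p\<close> is on the same side of \<open>c\<close> as \<open>d\<close>; this is used with \<open>m\<close> and \<open>M\<close> in
      both orders.\<close>
    have side: "(d - c) * (p - c) \<ge> 0"
      if "line_to_real \<omega> c \<inter> interior (B \<inter> {z. Im z \<le> 0}) = {}" "of_real c \<in> B" "of_real d \<in> B" for c d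
    proof (rule ccontr)
      define k where "k = (Re \<omega> - c) / Im \<omega>"
      have k: "Re \<omega> = k * Im \<omega> + c" using \<omega> by (simp add: k_def)
      have "p - c = s * (Re b - k * Im b - c) + k * (Im \<omega> - s * (Im \<omega> - Im b))"
        unfolding p_def k by (simp add: algebra_simps)
      then have pc: "p - c = s * (Re b - k * Im b - c)" using sI by simp
      assume "\<not> (d - c) * (p - c) \<ge> 0"
      then have "s * ((d - c) * (Re b - k * Im b - c)) < 0" unfolding pc by (simp add: mult.left_commute)
      then have "(d - c) * (Re b - k * Im b - c) < 0" using s by (simp add: mult_less_0_iff)
      with low that b Imb obtain z where "z \<in> interior (B \<inter> {z. Im z \<le> 0})" "Re z = k * Im z + c"
        using line_meets_triangle_interior[of "B \<inter> {z. Im z \<le> 0}" c d b k] by auto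
      with that(1) show False by (auto simp: line_to_real_def k_def)
    qed
    have "m \<le> p" using side[OF avoid(1) ends(1,2)] ends(3) by (simp add: zero_le_mult_iff)
    moreover have "p \<le> M" using side[OF avoid(2) ends(2,1)] ends(3) by (simp add: zero_le_mult_iff)
    ultimately have "p \<in> closed_segment m M" using ends by (simp add: closed_segment_eq_real_ivl)
    then have "complex_of_real p \<in> closed_segment (of_real m) (of_real M)"
      by (metis closed_segment_of_real imageI)
    moreover have "closed_segment (complex_of_real m) (of_real M) \<subseteq> B \<inter> {z. Im z \<ge> 0}"
      using up ends by (intro closed_segment_subset) auto
    ultimately have pB: "of_real p \<in> B" by blast
    have "closed_segment \<omega> (of_real p) \<subseteq> B \<inter> {z. Im z \<ge> 0}"
      using up \<omega> pB by (intro closed_segment_subset) auto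
    moreover have "closed_segment (of_real p) b \<subseteq> B \<inter> {z. Im z \<le> 0}"
      using low b pB Imb by (intro closed_segment_subset) auto
    moreover have "of_real p \<in> closed_segment \<omega> b"
      unfolding p in_segment using s by (intro exI[of _ s]) simp
    ultimately show ?thesis
      using Un_closed_segment[of "of_real p" \<omega> b] by blast
  qed
  then show ?thesis
    using \<omega>(1) unfolding star_center_def by (fastforce simp: in_segment)
qed

theorem theorem4p1:
  fixes A :: "quat ^ 'n ^ 'n"
    and W :: "quat set"
    and B Bplus Bminus :: "complex set"
    and m M :: real
    and \<omega> :: complex
  assumes "CARD('n) \<ge> 2"
    and "\<not> hermitian A"
    and "W = numerical_range A"
    and "B = complex_part_of W"
    and "Bplus = B \<inter> {z. Im z \<ge> 0}"
    and "Bminus = B \<inter> {z. Im z \<le> 0}"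
    and "m = (LEAST r. r \<in> real_part_of W)"
    and "M = (GREATEST r. r \<in> real_part_of W)"
    and "m < M"
    and "\<omega> \<in> Bplus"
    and "Im \<omega> > 0"
  shows "\<omega> \<in> star_center B \<longleftrightarrow>
    (line_to_real \<omega> m \<inter> interior Bminus) \<union> (line_to_real \<omega> M \<inter> interior Bminus) = {}"
proof -
  note W = \<open>W = numerical_range A\<close> and B = \<open>B = complex_part_of W\<close>
    and Bminus = \<open>Bminus = B \<inter> {z. Im z \<le> 0}\<close>
  have real_B: "of_real r \<in> B \<longleftrightarrow> r \<in> real_part_of W" for r
    unfolding B by (rule of_real_mem_complex_part_iff)
  have "compact (real_part_of W)" unfolding W by (rule compact_real_part)
  note extrema = Least_less_Greatest_imp_extrema[OF this \<open>m < M\<close>[unfolded assms(7,8)],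
      folded assms(7,8), folded real_B]
  have up: "convex (B \<inter> {z. Im z \<ge> 0})"
    unfolding B W by (rule convex_upper_complex_part)
  have cnj: "cnj z \<in> B \<longleftrightarrow> z \<in> B" for z
    using cnj_mem_complex_part[of z A] cnj_mem_complex_part[of "cnj z" A] unfolding B W by auto
  have "Bminus = cnj ` (B \<inter> {z. Im z \<ge> 0})"
  proof (intro set_eqI iffI)
    fix z assume "z \<in> Bminus"
    then show "z \<in> cnj ` (B \<inter> {z. Im z \<ge> 0})"
      by (intro image_eqI[of _ _ "cnj z"]) (auto simp: Bminus cnj)
  qed (auto simp: Bminus cnj)
  then have low: "convex Bminus"
    using up by (simp add: convex_linear_image linear_cnj)
  show ?thesis
  proof
    assume star: "\<omega> \<in> star_center B"
    have "line_to_real \<omega> m \<inter> interior Bminus = {}"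
      using star_center_line_meets_interior[OF star \<open>Im \<omega> > 0\<close>, of _ m] extrema(3)
      unfolding Bminus by fastforce
    moreover have "line_to_real \<omega> M \<inter> interior Bminus = {}"
      using star_center_line_meets_interior[OF star \<open>Im \<omega> > 0\<close>, of _ M] extrema(4)
      unfolding Bminus by fastforce
    ultimately show "(line_to_real \<omega> m \<inter> interior Bminus) \<union> (line_to_real \<omega> M \<inter> interior Bminus) = {}"
      by simp
  next
    assume "(line_to_real \<omega> m \<inter> interior Bminus) \<union> (line_to_real \<omega> M \<inter> interior Bminus) = {}"
    then show "\<omega> \<in> star_center B"
      using up low extrema(1,2) assms(5,9-11) unfolding Bminus
      by (intro star_center_if_lines_avoid_interior[of B m M]) auto
  qed
qed

end
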